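(* Let $\mathcal{A}$ be a finite alphabet, let $B\subseteq\mathcal{A}^{\Delta_1}$ be an allowable set such that for every $\alpha\in\mathcal{A}$ there is a block in $B$ whose root label is $\alpha$ (so that every block in $B$ is extensible), let $X$ be the tree shift of finite type induced by $B$, and let $\mathcal{G}$ be the extended directed graph representation of $X$. Every sequence of successive $(d,c)$-reductions starting from $\mathcal{G}$ is finite; and if $\overline{\mathcal{G}}$ is a $(d,c)$-irreducible extended directed graph obtained from $\mathcal{G}$ by finitely many (possibly zero) successive $(d,c)$-reductions, then $X$ is CPC-irreducible if and only if the intrinsic graph $\overline{\mathcal{G}}^c$ is strongly connected. Consequently, there is an algorithm which, given a finite alphabet $\mathcal{A}$ and an allowable set $B\subseteq\mathcal{A}^{\Delta_1}$ such that for every $\alpha\in\mathcal{A}$ there is a block in $B$ whose root label is $\alpha$, decides whether the tree shift of finite type $X$ induced by $B$ is CPC-irreducible.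
   Context: Let $\Sigma=\{s_1,s_2\}$ and let $\Sigma^*$ be the set of all finite words over $\Sigma$ (the infinite dyadic tree), with empty word $\epsilon$; $|g|$ is the length of $g$, and $\Delta_n=\{g\in\Sigma^*: |g|\le n\}$. A labeled tree over a finite alphabet $\mathcal{A}$ is a function $t:\Sigma^*\to\mathcal{A}$, $g\mapsto t_g$. An $n$-block is a function $u:\Delta_n\to\mathcal{A}$; it appears in $t$ if for some $g\in\Sigma^*$, $t_{gw}=u_w$ for all $w\in\Delta_n$. A $1$-block $u$ with $u_\epsilon=\alpha,u_{s_1}=\beta,u_{s_2}=\gamma$ is written $\alpha\to(\beta,\gamma)$. For $B\subseteq\mathcal{A}^{\Delta_1}$, the tree shift of finite type (TSFT) induced by the allowable set $B$ is the set of all labeled trees $t$ with $t_g\to(t_{gs_1},t_{gs_2})\in B$ for all $g\in\Sigma^*$. A finite set $S\subseteq\Sigma^*$ is a prefix code if no word in $S$ is a prefix of another word in $S$; it is a complete prefix code (CPC) if moreover every $w\in\Sigma^*$ with $|w|\ge\max\{|g|:g\in S\}$ has a (not necessarily proper) prefix in $S$. Let $B_n(X)$ be the set of $n$-blocks appearing in elements of $X$. A tree shift $X$ is CPC-irreducible if for all $n$ and all $u,v\in B_n(X)$ there are $x\in X$ and a CPC $P\subset\bigcup_{k>n}\Sigma^k$ such that $x_w=u_w$ and $x_{gw}=v_w$ for all $w\in\Delta_n$ and $g\in P$. An extended directed graph is a triple $\mathcal{G}=(V,E_c,E_d)$ with $V$ a finite vertex set, $E_c\subset V\times V$ (convergent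 edges) and $E_d\subset V\times V\times V$ (divergent edges), where every $(\alpha,\beta,\gamma)\in E_d$ satisfies $\beta\ne\gamma$. Its intrinsic graph is the directed graph $\mathcal{G}^c=(V,E_c)$. A directed graph is strongly connected if for any two vertices $v_1,v_2$ there is a directed path from $v_1$ to $v_2$. The extended directed graph representation of the TSFT induced by $B$ has $V=\mathcal{A}$, $E_c=\{(\alpha,\beta):\alpha\to(\beta,\beta)\in B\}$, $E_d=\{(\alpha,\beta,\gamma):\beta\ne\gamma,\ \alpha\to(\beta,\gamma)\in B\}$. $\mathcal{G}=(V,E_c,E_d)$ is $(d,c)$-reducible if there are $\alpha,\beta,\gamma\in V$ such that $(\alpha,\beta,\gamma)\in E_d$ or $(\alpha,\gamma,\beta)\in E_d$, there is a directed path in $\mathcal{G}^c$ from $\beta$ to $\gamma$, and $(\alpha,\gamma)\notin E_c$; in that case $(V,E_c\cup\{(\alpha,\gamma)\},E_d)$ is called a $(d,c)$-reduction of $\mathcal{G}$. $\mathcal{G}$ is $(d,c)$-irreducible if it is not $(d,c)$-reducible. *)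

theory Defs
  imports Main "HOL-Library.FuncSet" "HOL-Library.Sublist" "HOL-Library.Nat_Bijection"
begin

section \<open>Labeled trees, blocks and tree shifts of finite type\<close>

datatype letter = s1 | s2

type_synonym word = "letter list"
type_synonym 'a tree = "word \<Rightarrow> 'a"
type_synonym 'a block = "word \<Rightarrow> 'a"

definition Delta :: "nat \<Rightarrow> word set" where
  "Delta n = {g. length g \<le> n}"

text \<open>An \<open>n\<close>-block is a function on \<open>Delta n\<close>; as usual for \<open>\<rightarrow>\<^sub>E\<close>, it is
  \<open>undefined\<close> outside its domain, so that equality of blocks is equality of functions.\<close>

definition blocks :: "'a set \<Rightarrow> nat \<Rightarrow> 'a block set" where
  "blocks A n = Delta n \<rightarrow>\<^sub>E A"

definition appears_in :: "nat \<Rightarrow> 'a block \<Rightarrow> 'a tree \<Rightarrow> bool" where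
  "appears_in n u t \<longleftrightarrow> (\<exists>g. \<forall>w\<in>Delta n. t (g @ w) = u w)"

definition blocks_of :: "'a set \<Rightarrow> 'a tree set \<Rightarrow> nat \<Rightarrow> 'a block set" where
  "blocks_of A X n = {u \<in> blocks A n. \<exists>t\<in>X. appears_in n u t}"

text \<open>The 1-block \<open>\<alpha> \<rightarrow> (\<beta>, \<gamma>)\<close>.\<close>

definition one_block :: "'a \<Rightarrow> 'a \<Rightarrow> 'a \<Rightarrow> 'a block" where
  "one_block \<alpha> \<beta> \<gamma> =
     (\<lambda>w\<in>Delta 1. if w = [] then \<alpha> else if w = [s1] then \<beta> else \<gamma>)"

definition TSFT :: "'a set \<Rightarrow> 'a block set \<Rightarrow> 'a tree set" where
  "TSFT A B = {t. (\<forall>g. t g \<in> A) \<and>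
                  (\<forall>g. one_block (t g) (t (g @ [s1])) (t (g @ [s2])) \<in> B)}"

text \<open>A finite alphabet with an allowable set in which every symbol is the root of
  some block.\<close>

definition allowable :: "'a set \<Rightarrow> 'a block set \<Rightarrow> bool" where
  "allowable A B \<longleftrightarrow>
     finite A \<and> B \<subseteq> blocks A 1 \<and> (\<forall>\<alpha>\<in>A. \<exists>u\<in>B. u [] = \<alpha>)"


section \<open>CPC-irreducibility\<close>

definition prefix_code :: "word set \<Rightarrow> bool" where
  "prefix_code S \<longleftrightarrow> finite S \<and> (\<forall>g\<in>S. \<forall>h\<in>S. \<not> strict_prefix g h)"

text \<open>The empty code is excluded explicitly, as \<open>Max {}\<close> is unspecified.\<close>

definition complete_prefix_code :: "word set \<Rightarrow> bool" where
  "complete_prefix_code S \<longleftrightarrow>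
     prefix_code S \<and> S \<noteq> {} \<and>
     (\<forall>w. length w \<ge> Max (length ` S) \<longrightarrow> (\<exists>g\<in>S. prefix g w))"

definition CPC_irreducible :: "'a set \<Rightarrow> 'a tree set \<Rightarrow> bool" where
  "CPC_irreducible A X \<longleftrightarrow>
     (\<forall>n. \<forall>u\<in>blocks_of A X n. \<forall>v\<in>blocks_of A X n.
        \<exists>x\<in>X. \<exists>P. complete_prefix_code P \<and> (\<forall>g\<in>P. length g > n) \<and>
          (\<forall>w\<in>Delta n. x w = u w \<and> (\<forall>g\<in>P. x (g @ w) = v w)))"


section \<open>Extended directed graphs\<close>

record 'a ext_digraph =
  verts :: "'a set"
  conv_edges :: "('a \<times> 'a) set"
  div_edges :: "('a \<times> 'a \<times> 'a) set"

definition is_ext_digraph :: "'a ext_digraph \<Rightarrow> bool" where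
  "is_ext_digraph G \<longleftrightarrow>
     finite (verts G) \<and>
     conv_edges G \<subseteq> verts G \<times> verts G \<and>
     div_edges G \<subseteq> verts G \<times> verts G \<times> verts G \<and>
     (\<forall>(\<alpha>, \<beta>, \<gamma>)\<in>div_edges G. \<beta> \<noteq> \<gamma>)"

type_synonym 'a digraph = "'a set \<times> ('a \<times> 'a) set"

definition intrinsic_graph :: "'a ext_digraph \<Rightarrow> 'a digraph" where
  "intrinsic_graph G = (verts G, conv_edges G)"

text \<open>Paths may have length 0.\<close>

definition has_path :: "'a digraph \<Rightarrow> 'a \<Rightarrow> 'a \<Rightarrow> bool" where
  "has_path D v w \<longleftrightarrow> v \<in> fst D \<and> w \<in> fst D \<and> (v, w) \<in> (snd D)\<^sup>*"

definition strongly_connected :: "'a digraph \<Rightarrow> bool" where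
  "strongly_connected D \<longleftrightarrow> (\<forall>v\<in>fst D. \<forall>w\<in>fst D. has_path D v w)"

definition graph_rep :: "'a set \<Rightarrow> 'a block set \<Rightarrow> 'a ext_digraph" where
  "graph_rep A B = \<lparr>
     verts = A,
     conv_edges = {(\<alpha>, \<beta>). \<alpha> \<in> A \<and> \<beta> \<in> A \<and> one_block \<alpha> \<beta> \<beta> \<in> B},
     div_edges = {(\<alpha>, \<beta>, \<gamma>). \<alpha> \<in> A \<and> \<beta> \<in> A \<and> \<gamma> \<in> A \<and> \<beta> \<noteq> \<gamma> \<and> one_block \<alpha> \<beta> \<gamma> \<in> B} \<rparr>"

definition dc_redex :: "'a ext_digraph \<Rightarrow> 'a \<Rightarrow> 'a \<Rightarrow> 'a \<Rightarrow> bool" where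
  "dc_redex G \<alpha> \<beta> \<gamma> \<longleftrightarrow>
     \<alpha> \<in> verts G \<and> \<beta> \<in> verts G \<and> \<gamma> \<in> verts G \<and>
     ((\<alpha>, \<beta>, \<gamma>) \<in> div_edges G \<or> (\<alpha>, \<gamma>, \<beta>) \<in> div_edges G) \<and>
     has_path (intrinsic_graph G) \<beta> \<gamma> \<and>
     (\<alpha>, \<gamma>) \<notin> conv_edges G"

definition dc_reducible :: "'a ext_digraph \<Rightarrow> bool" where
  "dc_reducible G \<longleftrightarrow> (\<exists>\<alpha> \<beta> \<gamma>. dc_redex G \<alpha> \<beta> \<gamma>)"

definition dc_irreducible :: "'a ext_digraph \<Rightarrow> bool" where
  "dc_irreducible G \<longleftrightarrow> \<not> dc_reducible G"

definition dc_reduction :: "'a ext_digraph \<Rightarrow> 'a ext_digraph \<Rightarrow> bool" where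
  "dc_reduction G G' \<longleftrightarrow>
     (\<exists>\<alpha> \<beta> \<gamma>. dc_redex G \<alpha> \<beta> \<gamma> \<and>
        G' = \<lparr> verts = verts G,
               conv_edges = conv_edges G \<union> {(\<alpha>, \<gamma>)},
               div_edges = div_edges G \<rparr>)"

lemma is_ext_digraph_graph_rep:
  "allowable A B \<Longrightarrow> is_ext_digraph (graph_rep A B)"
  unfolding allowable_def is_ext_digraph_def graph_rep_def by auto

lemma is_ext_digraph_dc_reduction:
  "dc_reduction G G' \<Longrightarrow> is_ext_digraph G \<Longrightarrow> is_ext_digraph G'"
  unfolding dc_reduction_def dc_redex_def is_ext_digraph_def by fastforce


section \<open>Algorithms\<close>

text \<open>Algorithms are programs for partial recursive functions (zero, successor,
  projections, composition, primitive recursion, unbounded minimization).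
  \<open>computes p xs y\<close> means that \<open>p\<close>, run on the arguments \<open>xs\<close>, halts with output \<open>y\<close>.\<close>

datatype program =
    Zero
  | Succ
  | Proj nat
  | Comp program "program list"
  | PrimRec program program
  | Minimize program

inductive computes :: "program \<Rightarrow> nat list \<Rightarrow> nat \<Rightarrow> bool" where
  zero: "computes Zero xs 0"
| succ: "computes Succ [x] (Suc x)"
| proj: "i < length xs \<Longrightarrow> computes (Proj i) xs (xs ! i)"
| comp: "list_all2 (\<lambda>q y. computes q xs y) qs ys \<Longrightarrow> computes p ys z
         \<Longrightarrow> computes (Comp p qs) xs z"
| primrec_0: "computes p xs y \<Longrightarrow> computes (PrimRec p q) (0 # xs) y"
| primrec_Suc: "computes (PrimRec p q) (n # xs) r \<Longrightarrow> computes q (n # r # xs) y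
         \<Longrightarrow> computes (PrimRec p q) (Suc n # xs) y"
| minimize: "computes p (y # xs) 0 \<Longrightarrow> (\<And>i. i < y \<Longrightarrow> \<exists>z. computes p (i # xs) (Suc z))
         \<Longrightarrow> computes (Minimize p) xs y"

inductive_cases computes_ZeroE: "computes Zero xs y"
inductive_cases computes_SuccE: "computes Succ xs y"
inductive_cases computes_ProjE: "computes (Proj i) xs y"
inductive_cases computes_CompE: "computes (Comp p qs) xs y"
inductive_cases computes_PrimRec0E: "computes (PrimRec p q) (0 # xs) y"
inductive_cases computes_PrimRecSucE: "computes (PrimRec p q) (Suc n # xs) y"
inductive_cases computes_MinimizeE: "computes (Minimize p) xs y"

lemma computes_deterministic:
  "computes p xs y \<Longrightarrow> computes p xs y' \<Longrightarrow> y = y'"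
proof (induction arbitrary: y' rule: computes.induct)
  case (zero xs)
  then show ?case by (rule computes_ZeroE) simp
next
  case (succ x)
  then show ?case by (rule computes_SuccE) simp
next
  case (proj i xs)
  from proj.prems show ?case by (rule computes_ProjE) simp
next
  case (comp xs qs ys p z)
  from comp.prems obtain ys' where
    ys': "list_all2 (\<lambda>q y. computes q xs y) qs ys'" "computes p ys' y'"
    by (rule computes_CompE)
  have "ys = ys'"
  proof (rule nth_equalityI)
    show "length ys = length ys'"
      using list_all2_lengthD[OF comp.IH(1)] list_all2_lengthD[OF ys'(1)] by simp
    fix i assume "i < length ys"
    then have "i < length qs" using list_all2_lengthD[OF comp.IH(1)] by simp
    then show "ys ! i = ys' ! i"
      using list_all2_nthD[OF comp.IH(1)] list_all2_nthD[OF ys'(1)] by blast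
  qed
  then show ?case using comp.IH(2) ys'(2) by blast
next
  case (primrec_0 p xs y q)
  from primrec_0.prems have "computes p xs y'" by (rule computes_PrimRec0E)
  then show ?case by (rule primrec_0.IH)
next
  case (primrec_Suc p q n xs r y)
  from primrec_Suc.prems obtain r' where
    r': "computes (PrimRec p q) (n # xs) r'" "computes q (n # r' # xs) y'"
    by (rule computes_PrimRecSucE)
  have "r = r'" using r'(1) by (rule primrec_Suc.IH(1))
  with r'(2) have "computes q (n # r # xs) y'" by (simp only:)
  then show ?case by (rule primrec_Suc.IH(2))
next
  case (minimize p y xs)
  from minimize.prems have
    y': "computes p (y' # xs) 0" "\<And>i. i < y' \<Longrightarrow> \<exists>z. computes p (i # xs) (Suc z)"
    by (rule computes_MinimizeE, blast)+
  have "\<not> y < y'"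
  proof
    assume "y < y'"
    then obtain z where "computes p (y # xs) (Suc z)" using y'(2) by blast
    then have "0 = Suc z" by (rule minimize.IH(1))
    then show False by simp
  qed
  moreover have "\<not> y' < y"
  proof
    assume "y' < y"
    then obtain z where "\<forall>x. computes p (y' # xs) x \<longrightarrow> Suc z = x"
      using minimize.IH(2) by blast
    then have "Suc z = 0" using y'(1) by blast
    then show False by simp
  qed
  ultimately show ?case by simp
qed

text \<open>\<open>p\<close> decides the property \<open>Q\<close> on the set \<open>I\<close> of instances: given any
  instance of \<open>I\<close>, encoded by \<open>enc\<close>, it halts with output 1 or 0 according to
  whether \<open>Q\<close> holds.\<close>

definition decides :: "program \<Rightarrow> ('i \<Rightarrow> nat list) \<Rightarrow> 'i set \<Rightarrow> ('i \<Rightarrow> bool) \<Rightarrow> bool" where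
  "decides p enc I Q \<longleftrightarrow> (\<forall>i\<in>I. computes p (enc i) (if Q i then 1 else 0))"

text \<open>The symbols presented to an algorithm are natural numbers; finite sets are given
  by their bit patterns, and a 1-block by a code of its three labels.\<close>

definition encode_one_block :: "nat block \<Rightarrow> nat" where
  "encode_one_block u = prod_encode (u [], prod_encode (u [s1], u [s2]))"

fun encode_instance :: "nat set \<times> nat block set \<Rightarrow> nat list" where
  "encode_instance (A, B) = [set_encode A, set_encode (encode_one_block ` B)]"

lemma Delta_1: "Delta 1 = {[], [s1], [s2]}"
proof (rule set_eqI)
  fix w
  show "w \<in> Delta 1 \<longleftrightarrow> w \<in> {[], [s1], [s2]}"
  proof (cases w)
    case Nil
    then show ?thesis by (simp add: Delta_def)
  next
    case (Cons a v)
    then show ?thesis by (cases a) (simp_all add: Delta_def)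
  qed
qed

lemma one_block_eta:
  assumes "u \<in> blocks A 1"
  shows "one_block (u []) (u [s1]) (u [s2]) = u"
proof (rule ext)
  fix w
  show "one_block (u []) (u [s1]) (u [s2]) w = u w"
  proof (cases "w \<in> Delta 1")
    case True
    then show ?thesis
      unfolding one_block_def Delta_1 by (elim insertE emptyE) simp_all
  next
    case False
    then have "u w = undefined"
      using assms PiE_arb unfolding blocks_def by fast
    then show ?thesis using False unfolding one_block_def by simp
  qed
qed

lemma inj_on_encode_one_block: "inj_on encode_one_block (blocks A 1)"
proof (rule inj_onI)
  fix u v
  assume uv: "u \<in> blocks A 1" "v \<in> blocks A 1" "encode_one_block u = encode_one_block v"
  have "u [] = v []" "u [s1] = v [s1]" "u [s2] = v [s2]"
    using uv(3) unfolding encode_one_block_def by simp_all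
  then have "one_block (u []) (u [s1]) (u [s2]) = one_block (v []) (v [s1]) (v [s2])"
    by (simp only:)
  then show "u = v" unfolding one_block_eta[OF uv(1)] one_block_eta[OF uv(2)] .
qed

lemma inj_on_encode_instance: "inj_on encode_instance {(A, B). allowable A B}"
proof (rule inj_onI, clarify)
  fix A B A' B'
  assume ok: "allowable A B" "allowable A' B'"
    and eq: "encode_instance (A, B) = encode_instance (A', B')"
  have fin: "finite (blocks C 1)" if "finite C" for C :: "nat set"
    using that unfolding blocks_def Delta_1 by (intro finite_PiE) auto
  have finA: "finite A" "finite A'" using ok by (auto simp: allowable_def)
  have sub: "B \<subseteq> blocks A 1" "B' \<subseteq> blocks A' 1" using ok by (auto simp: allowable_def)
  have finB: "finite B" "finite B'"
    using finite_subset[OF sub(1) fin[OF finA(1)]] finite_subset[OF sub(2) fin[OF finA(2)]]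
    by simp_all
  have A: "A = A'"
    using eq finA by (simp add: set_encode_eq)
  have "encode_one_block ` B = encode_one_block ` B'"
    using eq finB by (simp add: set_encode_eq)
  then have "B = B'"
    using inj_on_image_eq_iff[OF inj_on_encode_one_block] sub A by blast
  with A show "A = A' \<and> B = B'" by simp
qed

end

theory Submission imports Defs begin

text \<open>Call \<open>a\<close> attracted to \<open>b\<close> if some finite tree of allowable blocks has root \<open>a\<close> and all
  leaves labeled \<open>b\<close>. Such trees can be grafted below any block, so \<open>X\<close> is CPC-irreducible iff
  every symbol is attracted to every other one. The relation is transitive, so every edge
  created by a \<open>(d,c)\<close>-reduction is an attraction, and strong connectedness suffices. Conversely,
  take \<open>b\<close> in a source component of an irreducible reduct. If both successors in a block lie
  in that component, they are joined by a path, so irreducibility gives the root a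
  convergent edge into the component, and the root lies in it as well. Hence only symbols of the
  component are attracted to \<open>b\<close>, and the component is everything.

  For the algorithm, attraction of everything to everything means that a set of symbols that
  meets \<open>A\<close> and is closed under pulling back along blocks contains \<open>A\<close>. Since sets are
  coded by bit patterns, this is a formula all of whose quantifiers are bounded by the code
  of \<open>A\<close>, and so it is primitive recursive.\<close>

section \<open>Attraction and CPC-irreducibility\<close>

text \<open>The target \<open>b\<close> comes first because it stays fixed during an induction:
  \<open>attracted B b a\<close> reads "\<open>a\<close> is attracted to \<open>b\<close>", and only
  the root \<open>a\<close> varies.\<close>

inductive attracted :: "'a block set \<Rightarrow> 'a \<Rightarrow> 'a \<Rightarrow> bool" for B b where
  refl: "attracted B b b"
| step: "one_block a c d \<in> B \<Longrightarrow> attracted B b c \<Longrightarrow> attracted B b d \<Longrightarrow> attracted B b a"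

lemma attracted_trans:
  assumes "attracted B b a" "attracted B c b"
  shows "attracted B c a"
  using assms by induction (auto intro: attracted.step)

section \<open>Allowable blocks and the trees built from them\<close>

lemma one_block_simps [simp]:
  "one_block a c d [] = a" "one_block a c d [s1] = c" "one_block a c d [s2] = d"
  by (simp_all add: one_block_def Delta_def)

lemma one_block_in_blocks_iff: "one_block a c d \<in> blocks A 1 \<longleftrightarrow> a \<in> A \<and> c \<in> A \<and> d \<in> A"
proof
  assume "one_block a c d \<in> blocks A 1"
  then have "\<forall>w\<in>Delta 1. one_block a c d w \<in> A" unfolding blocks_def by (auto simp: PiE_iff)
  then show "a \<in> A \<and> c \<in> A \<and> d \<in> A" unfolding Delta_1 by simp
qed (auto simp: one_block_def blocks_def PiE_iff)

lemma allowable_one_blockD: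
  assumes "allowable A B" "one_block a c d \<in> B"
  shows "a \<in> A" "c \<in> A" "d \<in> A"
  using assms one_block_in_blocks_iff[of a c d A] unfolding allowable_def by auto

lemma allowable_one_block_ex:
  assumes "allowable A B" "a \<in> A"
  obtains c d where "one_block a c d \<in> B"
proof -
  obtain u where "u \<in> B" "u [] = a" "u \<in> blocks A 1"
    using assms unfolding allowable_def by blast
  then have "one_block a (u [s1]) (u [s2]) \<in> B" using one_block_eta by metis
  then show thesis by (rule that)
qed

lemma TSFT_shift: "t \<in> TSFT A B \<Longrightarrow> (\<lambda>w. t (g @ w)) \<in> TSFT A B"
  unfolding TSFT_def using append_assoc by (auto simp flip: append_assoc)

lemma TSFT_Cons: "t \<in> TSFT A B \<Longrightarrow> (\<lambda>w. t (s # w)) \<in> TSFT A B"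
  using TSFT_shift[of t A B "[s]"] by simp

lemma TSFT_ex_root:
  assumes ok: "allowable A B" and a: "a \<in> A"
  shows "\<exists>t\<in>TSFT A B. t [] = a"
proof -
  have "\<forall>x\<in>A. \<exists>q. one_block x (fst q) (snd q) \<in> B"
    using allowable_one_block_ex[OF ok] by (metis fst_conv snd_conv)
  then obtain f where f: "\<And>x. x \<in> A \<Longrightarrow> one_block x (fst (f x)) (snd (f x)) \<in> B"
    by metis
  \<comment> \<open>With one block \<open>f\<close> chosen per root symbol, \<open>t\<close> is the
    run of the resulting deterministic automaton started in \<open>a\<close>. Since
    \<open>foldl\<close> reads from the left, appending a letter to a word makes one further
    transition.\<close>
  define t where "t = foldl (\<lambda>x s. case s of s1 \<Rightarrow> fst (f x) | s2 \<Rightarrow> snd (f x)) a"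
  have step: "t (g @ [s1]) = fst (f (t g))" "t (g @ [s2]) = snd (f (t g))" for g
    by (simp_all add: t_def)
  have "t g \<in> A" for g
  proof (induction g rule: rev_induct)
    case Nil
    then show ?case using a by (simp add: t_def)
  next
    case (snoc s g)
    then show ?case
      using allowable_one_blockD[OF ok f[OF snoc]] step[of g] by (cases s) auto
  qed
  then have "t \<in> TSFT A B" unfolding TSFT_def using f by (simp add: step)
  moreover have "t [] = a" by (simp add: t_def)
  ultimately show ?thesis by blast
qed

fun node :: "'a \<Rightarrow> 'a tree \<Rightarrow> 'a tree \<Rightarrow> 'a tree" where
  "node a t t' [] = a"
| "node a t t' (s1 # w) = t w"
| "node a t t' (s2 # w) = t' w"

lemma node_in_TSFT:
  assumes "t \<in> TSFT A B" "t' \<in> TSFT A B" "a \<in> A" "one_block a (t []) (t' []) \<in> B"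
  shows "node a t t' \<in> TSFT A B"
proof -
  have "node a t t' g \<in> A \<and>
      one_block (node a t t' g) (node a t t' (g @ [s1])) (node a t t' (g @ [s2])) \<in> B" for g
    using assms unfolding TSFT_def by (cases "(a, t, t', g)" rule: node.cases) auto
  then show ?thesis unfolding TSFT_def by blast
qed

section \<open>Complete prefix codes as leaf sets of finite trees\<close>

lemma complete_prefix_code_Nil: "complete_prefix_code {[]}"
  by (auto simp: complete_prefix_code_def prefix_code_def)

text \<open>Removing the first letter from a word that is long for the joint code leaves a word that
  is long for the code on that side.\<close>

lemma complete_prefix_code_node:
  assumes P: "complete_prefix_code P" and P': "complete_prefix_code P'"
  shows "complete_prefix_code (Cons s1 ` P \<union> Cons s2 ` P')" (is "complete_prefix_code ?R")
proof -
  have fin: "finite P" "finite P'" "finite ?R" and ne: "P \<noteq> {}" "P' \<noteq> {}" "?R \<noteq> {}"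
    using P P' by (auto simp: complete_prefix_code_def prefix_code_def)
  have "\<exists>g\<in>?R. prefix g w" if w: "length w \<ge> Max (length ` ?R)" for w
  proof -
    have bound: "length g \<le> length w" if "g \<in> ?R" for g
      using w that fin(3) by (meson Max_ge finite_imageI image_eqI order_trans)
    show ?thesis
    proof (cases w)
      \<comment> \<open>Impossible: the joint code contains a nonempty word, so the bound on
        \<open>w\<close> is positive.\<close>
      case Nil
      obtain g where "g \<in> P" using ne by blast
      then show ?thesis using bound[of "s1 # g"] Nil by simp
    next
      case (Cons s v)
      show ?thesis
      proof (cases s)
        case s1
        have "length g \<le> length v" if "g \<in> P" for g
          using bound[of "s1 # g"] that Cons s1 by simp
        then have "Max (length ` P) \<le> length v" using fin ne by simp
        then obtain g where "g \<in> P" "prefix g v"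
          using P unfolding complete_prefix_code_def by blast
        then show ?thesis using Cons s1 by (intro bexI[of _ "s1 # g"]) auto
      next
        case s2
        have "length g \<le> length v" if "g \<in> P'" for g
          using bound[of "s2 # g"] that Cons s2 by simp
        then have "Max (length ` P') \<le> length v" using fin ne by simp
        then obtain g where "g \<in> P'" "prefix g v"
          using P' unfolding complete_prefix_code_def by blast
        then show ?thesis using Cons s2 by (intro bexI[of _ "s2 # g"]) auto
      qed
    qed
  qed
  moreover have "prefix_code ?R"
    using P P' fin(3) unfolding complete_prefix_code_def prefix_code_def by auto
  ultimately show ?thesis using ne unfolding complete_prefix_code_def by blast
qed

text \<open>Take the finite tree that witnesses the attraction and paste \<open>T\<close> at each
  leaf; the code is the set of leaves. The tree of depth 0 gives \<open>T\<close> itself with the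
  code \<open>{[]}\<close>.\<close>

lemma attracted_imp_graft:
  assumes ok: "allowable A B" and T: "T \<in> TSFT A B"
    and "attracted B (T []) a"
  shows "\<exists>t\<in>TSFT A B. \<exists>P. complete_prefix_code P \<and> t [] = a \<and> (\<forall>g\<in>P. \<forall>w. t (g @ w) = T w)"
  using assms(3)
proof induction
  case refl
  then show ?case using T complete_prefix_code_Nil by fastforce
next
  case (step a c d)
  from step.IH obtain t P t' P' where
    t: "t \<in> TSFT A B" "complete_prefix_code P" "t [] = c" "\<forall>g\<in>P. \<forall>w. t (g @ w) = T w" and
    t': "t' \<in> TSFT A B" "complete_prefix_code P'" "t' [] = d" "\<forall>g\<in>P'. \<forall>w. t' (g @ w) = T w"
    by blast
  have "node a t t' \<in> TSFT A B"
    using t t' step allowable_one_blockD[OF ok step(1)] by (intro node_in_TSFT) auto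
  moreover note complete_prefix_code_node[OF t(2) t'(2)]
  moreover have "\<forall>g\<in>Cons s1 ` P \<union> Cons s2 ` P'. \<forall>w. node a t t' (g @ w) = T w"
    using t t' by auto
  ultimately show ?case by (metis node.simps(1))
qed

text \<open>Keep \<open>t\<close> down to depth \<open>m\<close> and apply the previous grafting at
  every node of depth \<open>m\<close>. The induction peels off the root, treating the two subtrees
  separately.\<close>

lemma attracted_imp_graft_below:
  assumes ok: "allowable A B" and T: "T \<in> TSFT A B"
    and all: "\<And>a. a \<in> A \<Longrightarrow> attracted B (T []) a"
    and "t \<in> TSFT A B"
  shows "\<exists>t'\<in>TSFT A B. \<exists>P. complete_prefix_code P \<and> (\<forall>g\<in>P. length g \<ge> m) \<and>
           (\<forall>w. length w \<le> m \<longrightarrow> t' w = t w) \<and> (\<forall>g\<in>P. \<forall>w. t' (g @ w) = T w)"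
  using assms(4)
proof (induction m arbitrary: t)
  case 0
  then have "t [] \<in> A" by (simp add: TSFT_def)
  from attracted_imp_graft[OF ok T all[OF this]] show ?case by auto
next
  case (Suc m)
  from Suc.IH[OF TSFT_Cons[OF Suc.prems, of s1]] obtain t1 P1 where
    1: "t1 \<in> TSFT A B" "complete_prefix_code P1" "\<forall>g\<in>P1. length g \<ge> m"
      "\<forall>w. length w \<le> m \<longrightarrow> t1 w = t (s1 # w)" "\<forall>g\<in>P1. \<forall>w. t1 (g @ w) = T w"
    by blast
  from Suc.IH[OF TSFT_Cons[OF Suc.prems, of s2]] obtain t2 P2 where
    2: "t2 \<in> TSFT A B" "complete_prefix_code P2" "\<forall>g\<in>P2. length g \<ge> m"
      "\<forall>w. length w \<le> m \<longrightarrow> t2 w = t (s2 # w)" "\<forall>g\<in>P2. \<forall>w. t2 (g @ w) = T w"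
    by blast
  let ?t = "node (t []) t1 t2" and ?P = "Cons s1 ` P1 \<union> Cons s2 ` P2"
  have "one_block (t []) (t ([] @ [s1])) (t ([] @ [s2])) \<in> B" "t [] \<in> A"
    using Suc.prems unfolding TSFT_def by blast+
  then have "?t \<in> TSFT A B" using 1 2 by (intro node_in_TSFT) auto
  moreover note complete_prefix_code_node[OF 1(2) 2(2)]
  moreover have "\<forall>g\<in>?P. length g \<ge> Suc m" using 1 2 by auto
  moreover have "?t w = t w" if "length w \<le> Suc m" for w
    using that 1 2 by (cases "(t [], t1, t2, w)" rule: node.cases) auto
  moreover have "\<forall>g\<in>?P. \<forall>w. ?t (g @ w) = T w" using 1 2 by auto
  ultimately show ?case by blast
qed

text \<open>The words with no code word strictly above them form a finite tree with leaf set
  \<open>P\<close>, which is read from the leaves up. The induction measure is the distance to the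
  maximal depth of the code.\<close>

lemma complete_prefix_code_imp_attracted:
  assumes x: "x \<in> TSFT A B" and P: "complete_prefix_code P"
    and b: "\<And>g. g \<in> P \<Longrightarrow> x g = b"
    and w: "\<not> (\<exists>g\<in>P. strict_prefix g w)"
  shows "attracted B b (x w)"
  using w
proof (induction "Max (length ` P) - length w" arbitrary: w rule: less_induct)
  case less
  show ?case
  proof (cases "w \<in> P")
    case True
    then show ?thesis using b attracted.refl by metis
  next
    case False
    then have no: "\<not> (\<exists>g\<in>P. prefix g w)"
      using less.prems by (metis strict_prefixI)
    \<comment> \<open>Completeness bounds the depth of the inner nodes. A strict prefix of
      \<open>w @ [s]\<close> is a prefix of \<open>w\<close>, so the children of \<open>w\<close>
      satisfy the hypothesis again.\<close>
    then have "length w < Max (length ` P)"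
      using P unfolding complete_prefix_code_def by (meson not_le)
    then have "attracted B b (x (w @ [s]))" for s
      using no by (intro less.hyps) (auto simp: strict_prefix_def)
    moreover have "one_block (x w) (x (w @ [s1])) (x (w @ [s2])) \<in> B"
      using x unfolding TSFT_def by blast
    ultimately show ?thesis by (blast intro: attracted.step)
  qed
qed

section \<open>The attraction criterion for CPC-irreducibility\<close>

lemma Delta_0: "Delta 0 = {[]}"
  by (auto simp: Delta_def)

theorem CPC_irreducible_iff_attracted:
  assumes ok: "allowable A B"
  shows "CPC_irreducible A (TSFT A B) \<longleftrightarrow> (\<forall>a\<in>A. \<forall>b\<in>A. attracted B b a)"
proof (intro iffI ballI)
  fix a b
  assume irr: "CPC_irreducible A (TSFT A B)" and a: "a \<in> A" and b: "b \<in> A"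
  \<comment> \<open>Blocks of height 0 are single symbols, so irreducibility at height 0 yields a
    tree with root \<open>a\<close> that carries \<open>b\<close> on a complete prefix code.\<close>
  define s where "s = (\<lambda>c. \<lambda>w\<in>Delta 0. c :: 'a)"
  have "s c \<in> blocks_of A (TSFT A B) 0" if c: "c \<in> A" for c
  proof -
    obtain t where "t \<in> TSFT A B" "t [] = c" using TSFT_ex_root[OF ok c] by blast
    then show ?thesis
      using c unfolding blocks_of_def blocks_def appears_in_def s_def Delta_0
      by (auto intro!: exI[of _ "[]"])
  qed
  then have "s a \<in> blocks_of A (TSFT A B) 0" "s b \<in> blocks_of A (TSFT A B) 0"
    using a b by simp_all
  with irr obtain x P where x: "x \<in> TSFT A B" "complete_prefix_code P"
    "\<forall>w\<in>Delta 0. x w = s a w \<and> (\<forall>g\<in>P. x (g @ w) = s b w)"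
    unfolding CPC_irreducible_def by blast
  then have "x [] = a" "\<And>g. g \<in> P \<Longrightarrow> x g = b" by (auto simp: s_def Delta_0)
  then show "attracted B b a"
    using complete_prefix_code_imp_attracted[OF x(1,2), of b "[]"] by auto
next
  assume all: "\<forall>a\<in>A. \<forall>b\<in>A. attracted B b a"
  show "CPC_irreducible A (TSFT A B)"
    unfolding CPC_irreducible_def
  proof (intro allI ballI)
    fix n u v
    assume u: "u \<in> blocks_of A (TSFT A B) n" and v: "v \<in> blocks_of A (TSFT A B) n"
    \<comment> \<open>A block appearing somewhere in a tree is moved to the root by passing to the
      subtree at that place.\<close>
    have extend: "\<exists>t\<in>TSFT A B. \<forall>w\<in>Delta n. t w = z w"
      if z: "z \<in> blocks_of A (TSFT A B) n" for z
    proof -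
      obtain t g where "t \<in> TSFT A B" "\<forall>w\<in>Delta n. t (g @ w) = z w"
        using z unfolding blocks_of_def appears_in_def by blast
      then show ?thesis using TSFT_shift[of t A B g] by (intro bexI[of _ "\<lambda>w. t (g @ w)"])
    qed
    obtain t where t: "t \<in> TSFT A B" "\<forall>w\<in>Delta n. t w = u w" using extend[OF u] by blast
    obtain T where T: "T \<in> TSFT A B" "\<forall>w\<in>Delta n. T w = v w" using extend[OF v] by blast
    have "T [] \<in> A" using T by (simp add: TSFT_def)
    \<comment> \<open>Grafting at depth \<open>Suc n\<close> leaves \<open>u\<close> intact and
      makes every code word longer than \<open>n\<close>.\<close>
    then obtain x P where x: "x \<in> TSFT A B" "complete_prefix_code P" "\<forall>g\<in>P. length g \<ge> Suc n"
      "\<forall>w. length w \<le> Suc n \<longrightarrow> x w = t w" "\<forall>g\<in>P. \<forall>w. x (g @ w) = T w"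
      using attracted_imp_graft_below[OF ok T(1) bspec[OF bspec[OF all]] t(1), of "Suc n"] by blast
    have "\<forall>w\<in>Delta n. x w = u w \<and> (\<forall>g\<in>P. x (g @ w) = v w)"
    proof
      fix w
      assume w: "w \<in> Delta n"
      then have "x w = t w" using x(4) by (simp add: Delta_def)
      then show "x w = u w \<and> (\<forall>g\<in>P. x (g @ w) = v w)" using w x(5) t(2) T(2) by simp
    qed
    then show "\<exists>x\<in>TSFT A B. \<exists>P. complete_prefix_code P \<and> (\<forall>g\<in>P. n < length g) \<and>
        (\<forall>w\<in>Delta n. x w = u w \<and> (\<forall>g\<in>P. x (g @ w) = v w))"
      using x(1-3) Suc_le_eq by blast
  qed
qed

section \<open>Reductions\<close>

lemma rtranclp_dc_reduction_preserves:
  assumes "dc_reduction\<^sup>*\<^sup>* G H"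
  shows "verts H = verts G" "div_edges H = div_edges G" "conv_edges G \<subseteq> conv_edges H"
  using assms by induction (auto simp: dc_reduction_def)

lemma no_infinite_dc_reductions:
  assumes "finite (verts G)"
  shows "\<nexists>f. f (0 :: nat) = G \<and> (\<forall>i. dc_reduction (f i) (f (Suc i)))"
proof
  assume "\<exists>f. f (0 :: nat) = G \<and> (\<forall>i. dc_reduction (f i) (f (Suc i)))"
  then obtain f where f: "f 0 = G" "\<And>i. dc_reduction (f i) (f (Suc i))" by blast
  \<comment> \<open>A reduction adds a pair of vertices that was not an edge. The vertex set never
    changes, so the finite set of missing pairs strictly shrinks.\<close>
  define missing where "missing i = verts G \<times> verts G - conv_edges (f i)" for i
  have V: "verts (f i) = verts G" for i
  proof (induction i)
    case (Suc i)
    then show ?case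
      using rtranclp_dc_reduction_preserves(1)[OF r_into_rtranclp[of dc_reduction, OF f(2)[of i]]] by simp
  qed (simp add: f)
  have "missing (Suc i) \<subset> missing i" for i
  proof -
    obtain a c where "a \<in> verts (f i)" "c \<in> verts (f i)" "(a, c) \<notin> conv_edges (f i)"
      "conv_edges (f (Suc i)) = conv_edges (f i) \<union> {(a, c)}"
      using f(2)[of i] unfolding dc_reduction_def dc_redex_def by force
    then show ?thesis unfolding V missing_def by blast
  qed
  moreover have "finite (missing i)" for i
    using assms unfolding missing_def by blast
  ultimately have "\<forall>i. (card (missing (Suc i)), card (missing i)) \<in> {(x, y). x < y}"
    by (simp add: psubset_card_mono)
  then show False
    using wf_no_infinite_down_chainE[OF wf_less, of "\<lambda>i. card (missing i)"] by blast
qed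

text \<open>For a new edge from \<alpha> to \<gamma>, the path from \<beta> to \<gamma> makes
  \<beta> attracted to \<gamma> by induction, and \<gamma> is attracted to itself. So both
  successors in the block at \<alpha> are attracted to \<gamma>.\<close>

lemma dc_reduct_edge_attracted:
  assumes "dc_reduction\<^sup>*\<^sup>* (graph_rep A B) G" "(a, c) \<in> conv_edges G"
  shows "attracted B c a"
  using assms
proof (induction arbitrary: a c)
  case base
  then show ?case
    unfolding graph_rep_def by (auto intro: attracted.step attracted.refl)
next
  case (step G H)
  from step.hyps(2) obtain \<alpha> \<beta> \<gamma> where redex: "dc_redex G \<alpha> \<beta> \<gamma>"
    and H: "conv_edges H = conv_edges G \<union> {(\<alpha>, \<gamma>)}"
    unfolding dc_reduction_def by auto
  have path: "attracted B c a" if "(a, c) \<in> (conv_edges G)\<^sup>*" for a c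
    using that by induction (auto intro: attracted.refl attracted_trans step.IH)
  have "attracted B \<gamma> \<beta>"
    using redex path unfolding dc_redex_def has_path_def intrinsic_graph_def by auto
  \<comment> \<open>Reductions leave the divergent edges alone, so the one used here still comes
    from a block of \<open>B\<close>.\<close>
  moreover have "one_block \<alpha> \<beta> \<gamma> \<in> B \<or> one_block \<alpha> \<gamma> \<beta> \<in> B"
    using redex rtranclp_dc_reduction_preserves[OF step.hyps(1)]
    unfolding dc_redex_def graph_rep_def by auto
  ultimately have "attracted B \<gamma> \<alpha>"
    by (auto intro: attracted.step attracted.refl)
  then show ?case using H step.prems step.IH by auto
qed

text \<open>Choose \<open>b\<close> with the fewest ancestors. An ancestor of \<open>b\<close> has
  no ancestors beyond those of \<open>b\<close>, so by minimality it has the same ones, among them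
  \<open>b\<close>.\<close>

lemma finite_source_component_ex:
  assumes "finite V" "V \<noteq> {}" "E \<subseteq> V \<times> V"
  shows "\<exists>b\<in>V. \<forall>a. (a, b) \<in> E\<^sup>* \<longrightarrow> (b, a) \<in> E\<^sup>*"
proof -
  define above where "above b = {a. (a, b) \<in> E\<^sup>*}" for b
  have sub: "above b \<subseteq> V" if "b \<in> V" for b
    using that assms(3) unfolding above_def by (auto elim: converse_rtranclE)
  obtain b where b: "b \<in> V" "\<And>a. a \<in> V \<Longrightarrow> card (above b) \<le> card (above a)"
    using assms(2) ex_has_least_nat[of "\<lambda>b. b \<in> V" _ "\<lambda>b. card (above b)"] by blast
  have "(b, a) \<in> E\<^sup>*" if "(a, b) \<in> E\<^sup>*" for a
  proof -
    have "above a \<subseteq> above b" using that unfolding above_def by auto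
    moreover have "a \<in> V" using sub[OF b(1)] that unfolding above_def by blast
    ultimately have "above a = above b"
      using b(2) sub[OF b(1)] assms(1) by (meson card_seteq finite_subset)
    then show ?thesis unfolding above_def by blast
  qed
  then show ?thesis using b(1) by blast
qed

theorem attracted_iff_strongly_connected:
  assumes ok: "allowable A B" and red: "dc_reduction\<^sup>*\<^sup>* (graph_rep A B) G"
    and irr: "dc_irreducible G"
  shows "(\<forall>a\<in>A. \<forall>b\<in>A. attracted B b a) \<longleftrightarrow> strongly_connected (intrinsic_graph G)"
proof -
  have V: "verts G = A"
    using rtranclp_dc_reduction_preserves(1)[OF red] by (simp add: graph_rep_def)
  show ?thesis
  proof
    assume sc: "strongly_connected (intrinsic_graph G)"
    have "attracted B c a" if "(a, c) \<in> (conv_edges G)\<^sup>*" for a c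
      using that
      by induction (auto intro: attracted.refl attracted_trans dc_reduct_edge_attracted[OF red])
    then show "\<forall>a\<in>A. \<forall>b\<in>A. attracted B b a"
      using sc V unfolding strongly_connected_def has_path_def intrinsic_graph_def by auto
  next
    assume all: "\<forall>a\<in>A. \<forall>b\<in>A. attracted B b a"
    show "strongly_connected (intrinsic_graph G)"
    proof (cases "A = {}")
      case True
      then show ?thesis using V by (simp add: strongly_connected_def intrinsic_graph_def)
    next
      case False
      have "is_ext_digraph G"
        using red is_ext_digraph_graph_rep[OF ok]
        by induction (auto intro: is_ext_digraph_dc_reduction)
      then obtain b where b: "b \<in> A" "\<And>a. (a, b) \<in> (conv_edges G)\<^sup>* \<Longrightarrow> (b, a) \<in> (conv_edges G)\<^sup>*"
        using finite_source_component_ex[of A "conv_edges G"] False V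
        unfolding is_ext_digraph_def by blast
      have reach: "(a, b) \<in> (conv_edges G)\<^sup>*" if "attracted B b a" for a
        using that
      proof induction
        case (step a c d)
        \<comment> \<open>Both successors reach \<open>b\<close>, and \<open>b\<close> lies in a
          source component, so \<open>b\<close> leads back to \<open>d\<close>.\<close>
        have "(c, d) \<in> (conv_edges G)\<^sup>*" using step.IH b(2) by (meson rtrancl_trans)
        \<comment> \<open>Equal successors give an original convergent edge, which survives all
          reductions. Different ones give a divergent edge, and the path from \<open>c\<close> to
          \<open>d\<close> then forces the edge from \<open>a\<close> to \<open>d\<close> by
          irreducibility.\<close>
        moreover have "(c = d \<and> (a, d) \<in> conv_edges G) \<or> (a, c, d) \<in> div_edges G"
          using step.hyps(1) allowable_one_blockD[OF ok step.hyps(1)]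
            rtranclp_dc_reduction_preserves[OF red]
          by (auto simp: graph_rep_def)
        ultimately have "(a, d) \<in> conv_edges G"
          using irr V allowable_one_blockD[OF ok step.hyps(1)]
          unfolding dc_irreducible_def dc_reducible_def dc_redex_def has_path_def intrinsic_graph_def
          by auto
        then show ?case using step.IH(2) by (rule converse_rtrancl_into_rtrancl)
      qed simp
      have "(a, c) \<in> (conv_edges G)\<^sup>*" if "a \<in> A" "c \<in> A" for a c
        using reach[of a] reach[of c] b all that by (meson rtrancl_trans)
      then show ?thesis
        using V unfolding strongly_connected_def has_path_def intrinsic_graph_def by auto
    qed
  qed
qed

section \<open>Computable functions\<close>

text \<open>Only lists of length \<open>k\<close> count; on other lists \<open>f\<close> is
  unconstrained, so formulas with \<open>!\<close> and \<open>drop\<close> may be used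
  freely.\<close>

definition computable :: "nat \<Rightarrow> (nat list \<Rightarrow> nat) \<Rightarrow> bool" where
  "computable k f \<longleftrightarrow> (\<exists>p. \<forall>xs. length xs = k \<longrightarrow> computes p xs (f xs))"

definition computable_pred :: "nat \<Rightarrow> (nat list \<Rightarrow> bool) \<Rightarrow> bool" where
  "computable_pred k P \<longleftrightarrow> computable k (\<lambda>xs. of_bool (P xs))"

lemma computable_cong:
  "computable k f \<Longrightarrow> (\<And>xs. length xs = k \<Longrightarrow> f xs = g xs) \<Longrightarrow> computable k g"
  unfolding computable_def by metis

text \<open>Bounded quantifiers put their variable in front of the argument list, so outer variables
  are found behind a \<open>drop\<close>.\<close>

lemma computable_drop_nth: "n + i < k \<Longrightarrow> computable k (\<lambda>xs. drop n xs ! i)"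
  unfolding computable_def using computes.proj[of "n + i"] by (intro exI[of _ "Proj (n + i)"]) auto

lemma computable_nth: "i < k \<Longrightarrow> computable k (\<lambda>xs. xs ! i)"
  using computable_drop_nth[of 0] by simp

lemma computable_comp:
  assumes g: "computable m g" and f: "\<And>i. i < m \<Longrightarrow> computable k (f i)"
  shows "computable k (\<lambda>xs. g (map (\<lambda>i. f i xs) [0..<m]))"
proof -
  obtain p where p: "\<And>xs. length xs = m \<Longrightarrow> computes p xs (g xs)"
    using g unfolding computable_def by blast
  obtain q where q: "\<And>i xs. i < m \<Longrightarrow> length xs = k \<Longrightarrow> computes (q i) xs (f i xs)"
    using f unfolding computable_def by metis
  have "computes (Comp p (map q [0..<m])) xs (g (map (\<lambda>i. f i xs) [0..<m]))"
    if "length xs = k" for xs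
    using that by (intro computes.comp[of xs _ "map (\<lambda>i. f i xs) [0..<m]"] p)
      (auto simp: list_all2_conv_all_nth q)
  then show ?thesis unfolding computable_def by blast
qed

lemma computable_comp1:
  assumes "computable 1 (\<lambda>xs. g (xs ! 0))" "computable k f"
  shows "computable k (\<lambda>xs. g (f xs))"
  using computable_comp[OF assms(1), of k "\<lambda>_. f"] assms(2) by simp

lemma computable_comp2:
  assumes "computable 2 (\<lambda>xs. g (xs ! 0) (xs ! 1))" "computable k f" "computable k f'"
  shows "computable k (\<lambda>xs. g (f xs) (f' xs))"
  using computable_comp[OF assms(1), of k "\<lambda>i. if i = 0 then f else f'"] assms(2,3)
  by (simp add: numeral_2_eq_2)

lemma computable_Suc:
  assumes "computable k f"
  shows "computable k (\<lambda>xs. Suc (f xs))"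
proof -
  have "computes Succ xs (Suc (xs ! 0))" if "length xs = 1" for xs
    using that computes.succ by (cases xs) auto
  then have "computable 1 (\<lambda>xs. Suc (xs ! 0))" unfolding computable_def by blast
  then show ?thesis using assms by (rule computable_comp1)
qed

lemma computable_const: "computable k (\<lambda>_. c)"
proof (induction c)
  case 0
  then show ?case unfolding computable_def using computes.zero by blast
next
  case (Suc c)
  then show ?case by (rule computable_Suc)
qed

lemma computable_primrec:
  assumes f: "computable k f" and g: "computable (k + 2) g" and b: "computable k b"
  shows "computable k (\<lambda>xs. rec_nat (f xs) (\<lambda>n r. g (n # r # xs)) (b xs))"
proof -
  obtain p q where p: "\<And>xs. length xs = k \<Longrightarrow> computes p xs (f xs)"
    and q: "\<And>xs. length xs = k + 2 \<Longrightarrow> computes q xs (g xs)"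
    using f g unfolding computable_def by blast
  have rec: "computes (PrimRec p q) (n # xs) (rec_nat (f xs) (\<lambda>n r. g (n # r # xs)) n)"
    if "length xs = k" for n xs
    using that p q by (induction n) (auto intro: computes.intros)
  have "computes (PrimRec p q) xs (rec_nat (f (tl xs)) (\<lambda>n r. g (n # r # tl xs)) (hd xs))"
    if "length xs = Suc k" for xs
    using that rec[of "tl xs" "hd xs"] by (cases xs) auto
  then have "computable (Suc k) (\<lambda>xs. rec_nat (f (tl xs)) (\<lambda>n r. g (n # r # tl xs)) (hd xs))"
    unfolding computable_def by blast
  \<comment> \<open>\<open>PrimRec\<close> recurses on its first argument. Index 0 supplies the
    bound \<open>b\<close> and the other indices are shifted projections, so the composed argument
    list is \<open>b xs # xs\<close>.\<close>
  then have "computable k (\<lambda>xs. (\<lambda>xs. rec_nat (f (tl xs)) (\<lambda>n r. g (n # r # tl xs)) (hd xs))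
      (map (\<lambda>i. (case i of 0 \<Rightarrow> b | Suc j \<Rightarrow> \<lambda>xs. xs ! j) xs) [0..<Suc k]))"
    by (rule computable_comp) (auto split: nat.splits intro: b computable_nth)
  then show ?thesis
  proof (rule computable_cong)
    fix xs :: "nat list"
    assume "length xs = k"
    then have "map (\<lambda>i. (case i of 0 \<Rightarrow> b | Suc j \<Rightarrow> \<lambda>xs. xs ! j) xs) [0..<Suc k] = b xs # xs"
      by (intro nth_equalityI) (auto simp: nth_Cons split: nat.splits simp del: upt_Suc)
    then show "(\<lambda>xs. rec_nat (f (tl xs)) (\<lambda>n r. g (n # r # tl xs)) (hd xs))
      (map (\<lambda>i. (case i of 0 \<Rightarrow> b | Suc j \<Rightarrow> \<lambda>xs. xs ! j) xs) [0..<Suc k]) =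
      rec_nat (f xs) (\<lambda>n r. g (n # r # xs)) (b xs)" by simp
  qed
qed

section \<open>Arithmetic, connectives and bounded quantifiers\<close>

lemma computable_add:
  assumes "computable k f" "computable k g"
  shows "computable k (\<lambda>xs. f xs + g xs)"
proof -
  have "rec_nat a (\<lambda>n r. Suc r) b = a + b" for a b by (induction b) auto
  then show ?thesis
    using computable_primrec[OF assms(1) computable_Suc[OF computable_nth[of 1]] assms(2)] by simp
qed

lemma computable_mult:
  assumes "computable k f" "computable k g"
  shows "computable k (\<lambda>xs. f xs * g xs)"
proof (rule computable_comp2[OF _ assms])
  \<comment> \<open>The step function receives \<open>n # r # xs\<close>: index 1 is the previous
    value, index 2 the first argument.\<close>
  have "computable 4 (\<lambda>xs. xs ! 1 + xs ! 2)" by (intro computable_add computable_nth) auto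
  then have "computable 2 (\<lambda>xs. rec_nat 0 (\<lambda>n r. r + xs ! 0) (xs ! 1))"
    using computable_primrec[OF computable_const[of 2 0] _ computable_nth[of 1 2],
        of "\<lambda>xs. xs ! 1 + xs ! 2"] by simp
  moreover have "rec_nat 0 (\<lambda>n r. r + a) b = a * b" for a b :: nat by (induction b) auto
  ultimately show "computable 2 (\<lambda>xs. xs ! 0 * xs ! 1)" by simp
qed

lemma computable_pred_not:
  assumes "computable_pred k P"
  shows "computable_pred k (\<lambda>xs. \<not> P xs)"
proof -
  have "rec_nat 1 (\<lambda>n r. 0) (of_bool a :: nat) = (of_bool (\<not> a) :: nat)" for a by simp
  then show ?thesis
    using computable_primrec[OF computable_const[of k 1] computable_const[of _ 0]]
      assms unfolding computable_pred_def by fastforce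
qed

lemma computable_pred_conj:
  "computable_pred k P \<Longrightarrow> computable_pred k Q \<Longrightarrow> computable_pred k (\<lambda>xs. P xs \<and> Q xs)"
  unfolding computable_pred_def of_bool_conj by (rule computable_mult)

lemma computable_pred_imp:
  assumes "computable_pred k P" "computable_pred k Q"
  shows "computable_pred k (\<lambda>xs. P xs \<longrightarrow> Q xs)"
  using computable_pred_not[OF computable_pred_conj[OF assms(1) computable_pred_not[OF assms(2)]]]
  by simp

lemma computable_pred_all_less:
  assumes P: "computable_pred (Suc k) (\<lambda>ys. P (ys ! 0) (drop 1 ys))" and b: "computable k b"
  shows "computable_pred k (\<lambda>xs. \<forall>i<b xs. P i xs)"
proof -
  \<comment> \<open>The recursion step sees \<open>n # r # xs\<close>, whereas the predicate expects
    \<open>n # xs\<close>; the reindexing skips \<open>r\<close>. The quantifier is then evaluated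
    as a product of truth values.\<close>
  have "computable (k + 2) (\<lambda>xs. (\<lambda>ys. of_bool (P (ys ! 0) (drop 1 ys)))
      (map (\<lambda>i. xs ! (if i = 0 then 0 else Suc i)) [0..<Suc k]))"
    using P unfolding computable_pred_def by (rule computable_comp) (auto intro: computable_nth)
  then have "computable (k + 2) (\<lambda>xs. of_bool (P (xs ! 0) (drop 2 xs)))"
  proof (rule computable_cong)
    fix xs :: "nat list"
    assume "length xs = k + 2"
    then have "map (\<lambda>i. xs ! (if i = 0 then 0 else Suc i)) [0..<Suc k] = xs ! 0 # drop 2 xs"
      by (intro nth_equalityI) (auto simp: nth_Cons split: nat.splits simp del: upt_Suc)
    then show "(\<lambda>ys. of_bool (P (ys ! 0) (drop 1 ys)))
      (map (\<lambda>i. xs ! (if i = 0 then 0 else Suc i)) [0..<Suc k]) =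
      (of_bool (P (xs ! 0) (drop 2 xs)) :: nat)" by simp
  qed
  then have "computable (k + 2) (\<lambda>xs. xs ! 1 * of_bool (P (xs ! 0) (drop 2 xs)))"
    by (intro computable_mult computable_nth) simp_all
  from computable_primrec[OF computable_const[of k 1] this b]
  have "computable k (\<lambda>xs. rec_nat 1 (\<lambda>n r. r * of_bool (P n xs)) (b xs))" by simp
  moreover have "rec_nat 1 (\<lambda>n r. r * of_bool (Q n)) m = (of_bool (\<forall>i<m. Q i) :: nat)" for Q m
    by (induction m) (auto simp: less_Suc_eq)
  ultimately show ?thesis unfolding computable_pred_def by simp
qed

lemma computable_pred_ex_less:
  assumes "computable_pred (Suc k) (\<lambda>ys. P (ys ! 0) (drop 1 ys))" "computable k b"
  shows "computable_pred k (\<lambda>xs. \<exists>i<b xs. P i xs)"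
  using computable_pred_not[OF computable_pred_all_less[OF computable_pred_not[OF assms(1)] assms(2)]]
  by simp

lemma computable_pred_odd:
  assumes "computable k f"
  shows "computable_pred k (\<lambda>xs. odd (f xs))"
proof -
  \<comment> \<open>The inner recursion exchanges 0 and 1; parity arises by iterating it from
    0.\<close>
  have "computable (k + 2) (\<lambda>xs. rec_nat 1 (\<lambda>_ _. 0) (xs ! 1))"
    using computable_primrec[OF computable_const[of _ 1] computable_const[of _ 0]
        computable_nth[of 1 "k + 2"]] by simp
  from computable_primrec[OF computable_const[of k 0] this assms]
  have "computable k (\<lambda>xs. rec_nat 0 (\<lambda>n r. rec_nat 1 (\<lambda>_ _. 0) r) (f xs))" by simp
  moreover have "rec_nat 0 (\<lambda>n r. rec_nat 1 (\<lambda>_ _. 0) r) m = (of_bool (odd m) :: nat)" for m :: nat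
    by (induction m) auto
  ultimately show ?thesis unfolding computable_pred_def by simp
qed

lemma computable_half:
  assumes "computable k f"
  shows "computable k (\<lambda>xs. f xs div 2)"
proof -
  have "computable (k + 2) (\<lambda>xs. xs ! 1 + of_bool (odd (xs ! 0)))"
    by (intro computable_add computable_nth
        computable_pred_odd[unfolded computable_pred_def]) simp_all
  from computable_primrec[OF computable_const[of k 0] this assms]
  have "computable k (\<lambda>xs. rec_nat 0 (\<lambda>n r. r + of_bool (odd n)) (f xs))" by simp
  \<comment> \<open>Half of \<open>m\<close>, rounded down, is the number of odd numbers below
    \<open>m\<close>.\<close>
  moreover have "rec_nat 0 (\<lambda>n r. r + of_bool (odd n)) m = m div 2" for m :: nat
    by (induction m) auto
  ultimately show ?thesis by simp
qed

section \<open>Bit patterns and pairs\<close>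

lemma computable_pred_set_decode:
  assumes "computable k f" "computable k g"
  shows "computable_pred k (\<lambda>xs. f xs \<in> set_decode (g xs))"
proof -
  have "computable (k + 2) (\<lambda>xs. xs ! 1 div 2)" by (intro computable_half computable_nth) simp
  from computable_primrec[OF assms(2) this assms(1)]
  have "computable k (\<lambda>xs. rec_nat (g xs) (\<lambda>n r. r div 2) (f xs))" by simp
  \<comment> \<open>Bit \<open>m\<close> of \<open>a\<close> is the parity of \<open>a\<close> after
    \<open>m\<close> halvings.\<close>
  moreover have "rec_nat a (\<lambda>n r. r div 2) m = a div 2 ^ m" for a m :: nat
    by (induction m) (auto simp: mult.commute simp flip: div_mult2_eq)
  ultimately show ?thesis using computable_pred_odd unfolding set_decode_def by simp
qed

lemma computable_prod_encode:
  assumes "computable k f" "computable k g"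
  shows "computable k (\<lambda>xs. prod_encode (f xs, g xs))"
proof -
  have "computable (k + 2) (\<lambda>xs. xs ! 1 + Suc (xs ! 0))"
    by (intro computable_add computable_Suc computable_nth) simp_all
  from computable_primrec[OF computable_const[of k 0] this computable_add[OF assms]]
  have "computable k (\<lambda>xs. rec_nat 0 (\<lambda>n r. r + Suc n) (f xs + g xs))" by simp
  moreover have "rec_nat 0 (\<lambda>n r. r + Suc n) m = triangle m" for m
    by (induction m) auto
  ultimately show ?thesis
    using assms unfolding prod_encode_def by (auto intro: computable_add)
qed

section \<open>The algorithm\<close>

text \<open>Here \<open>x\<close>, \<open>y\<close> and \<open>z\<close> code the alphabet, the
  blocks and a set of symbols. The bound \<open>x\<close> covers the whole alphabet, as the elements
  of a set are smaller than its code.\<close>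

definition closed_code :: "nat \<Rightarrow> nat \<Rightarrow> nat \<Rightarrow> bool" where
  "closed_code x y z \<longleftrightarrow> (\<forall>a<x. \<forall>c<x. \<forall>d<x.
     prod_encode (a, prod_encode (c, d)) \<in> set_decode y \<longrightarrow>
     c \<in> set_decode z \<and> d \<in> set_decode z \<longrightarrow> a \<in> set_decode z)"

text \<open>The range of \<open>z\<close> includes the codes of all subsets of the alphabet, because
  \<open>set_encode\<close> is monotone.\<close>

definition all_attracted_code :: "nat \<Rightarrow> nat \<Rightarrow> bool" where
  "all_attracted_code x y \<longleftrightarrow> (\<forall>z<Suc x.
     (\<exists>b<x. b \<in> set_decode x \<and> b \<in> set_decode z) \<and> closed_code x y z \<longrightarrow>
     (\<forall>a<x. a \<in> set_decode x \<longrightarrow> a \<in> set_decode z))"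

lemma computable_pred_all_attracted_code:
  "computable_pred 2 (\<lambda>xs. all_attracted_code (xs ! 0) (xs ! 1))"
  unfolding all_attracted_code_def closed_code_def
  \<comment> \<open>The closure rules follow the syntax of the formula; \<open>drop_drop\<close>
    merges the drops left by nested quantifiers.\<close>
  by ((rule computable_pred_all_less computable_pred_ex_less computable_pred_imp
        computable_pred_conj computable_pred_set_decode computable_prod_encode
        computable_Suc computable_nth computable_drop_nth | simp only: drop_drop | simp))+

lemma mem_less_set_encode:
  assumes "finite A" "a \<in> A"
  shows "a < set_encode A"
proof -
  have "2 ^ a \<le> set_encode A"
    unfolding set_encode_def using assms by (intro member_le_sum) auto
  then show ?thesis using less_exp[of a] by linarith
qed

lemma set_encode_mono:
  assumes "U \<subseteq> A" "finite A"
  shows "set_encode U \<le> set_encode A"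
  unfolding set_encode_def using assms by (intro sum_mono2) auto

lemma all_attracted_code_iff:
  assumes ok: "allowable A B"
  shows "all_attracted_code (set_encode A) (set_encode (encode_one_block ` B)) \<longleftrightarrow>
           (\<forall>a\<in>A. \<forall>b\<in>A. attracted B b a)" (is "all_attracted_code ?x ?y \<longleftrightarrow> _")
proof -
  have A: "finite A" and B: "B \<subseteq> blocks A 1" using ok by (auto simp: allowable_def)
  have "finite (blocks A 1)"
    using A unfolding blocks_def Delta_1 by (intro finite_PiE) auto
  then have "finite B" using B finite_subset by blast
  then have "set_decode ?y = encode_one_block ` B" by simp
  moreover have "prod_encode (a, prod_encode (c, d)) = encode_one_block (one_block a c d)" for a c d
    by (simp add: encode_one_block_def)
  \<comment> \<open>A block of \<open>B\<close> is determined by its three labels, so no other block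
    of \<open>B\<close> can produce this code.\<close>
  moreover have "encode_one_block (one_block a c d) \<in> encode_one_block ` B \<longleftrightarrow> one_block a c d \<in> B"
    for a c d
  proof
    assume "encode_one_block (one_block a c d) \<in> encode_one_block ` B"
    then obtain u where u: "u \<in> B" "encode_one_block (one_block a c d) = encode_one_block u"
      by blast
    then have "u [] = a" "u [s1] = c" "u [s2] = d" by (simp_all add: encode_one_block_def)
    then show "one_block a c d \<in> B" using one_block_eta[of u A] u(1) B by auto
  qed simp
  ultimately have y: "prod_encode (a, prod_encode (c, d)) \<in> set_decode ?y \<longleftrightarrow> one_block a c d \<in> B"
    for a c d by simp
  have x: "a \<in> set_decode ?x \<longleftrightarrow> a \<in> A" and less: "a \<in> A \<Longrightarrow> a < ?x" for a
    using A mem_less_set_encode by auto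
  show ?thesis
  proof (intro iffI ballI)
    fix a b
    assume code: "all_attracted_code ?x ?y" and ab: "a \<in> A" "b \<in> A"
    \<comment> \<open>The smallest closed set containing \<open>b\<close>; applying the test to its
      code shows that it is all of \<open>A\<close>.\<close>
    define U where "U = {c \<in> A. attracted B b c}"
    have "finite U" using A by (simp add: U_def)
    then have U: "set_decode (set_encode U) = U" by simp
    have "set_encode U < Suc ?x" using set_encode_mono[OF _ A, of U] by (auto simp: U_def)
    moreover have "b < ?x \<and> b \<in> set_decode ?x \<and> b \<in> set_decode (set_encode U)"
      using ab less unfolding U x by (auto simp: U_def attracted.refl)
    moreover have "closed_code ?x ?y (set_encode U)"
      unfolding closed_code_def U y using allowable_one_blockD(1)[OF ok]
      by (auto simp: U_def intro: attracted.step)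
    ultimately have "\<forall>a<?x. a \<in> set_decode ?x \<longrightarrow> a \<in> set_decode (set_encode U)"
      using code unfolding all_attracted_code_def by blast
    then show "attracted B b a" using ab less unfolding U x by (auto simp: U_def)
  next
    assume all: "\<forall>a\<in>A. \<forall>b\<in>A. attracted B b a"
    show "all_attracted_code ?x ?y"
      unfolding all_attracted_code_def
    proof (intro allI impI)
      fix z a
      assume z: "(\<exists>b<?x. b \<in> set_decode ?x \<and> b \<in> set_decode z) \<and> closed_code ?x ?y z"
        and a: "a \<in> set_decode ?x"
      then obtain b where b: "b \<in> A" "b \<in> set_decode z" using x by blast
      \<comment> \<open>A closed set that contains \<open>b\<close> absorbs, by induction, every
        symbol attracted to \<open>b\<close>.\<close>
      have "c \<in> set_decode z" if "attracted B b c" for c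
        using that
      proof induction
        case (step c d e)
        then show ?case
          using z less allowable_one_blockD[OF ok step.hyps(1)] y unfolding closed_code_def by blast
      qed (rule b)
      then show "a \<in> set_decode z" using all a b x by blast
    qed
  qed
qed

theorem CPC_irreducible_decidable:
  "\<exists>p. decides p encode_instance {(A, B). allowable A B}
         (\<lambda>(A, B). CPC_irreducible A (TSFT A B))"
proof -
  obtain p where p:
    "\<And>xs. length xs = 2 \<Longrightarrow> computes p xs (of_bool (all_attracted_code (xs ! 0) (xs ! 1)))"
    using computable_pred_all_attracted_code unfolding computable_pred_def computable_def by blast
  have "computes p (encode_instance (A, B)) (if CPC_irreducible A (TSFT A B) then 1 else 0)"
    if ok: "allowable A B" for A B
    using p[of "encode_instance (A, B)"]
    by (simp add: all_attracted_code_iff[OF ok] CPC_irreducible_iff_attracted[OF ok] of_bool_def)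
  then show ?thesis unfolding decides_def by (intro exI[of _ p]) auto
qed

theorem mainTheorem1:
  shows
    "(\<forall>(A :: 'a set) (B :: 'a block set). allowable A B \<longrightarrow>
        (\<nexists>f. f (0 :: nat) = graph_rep A B \<and> (\<forall>i. dc_reduction (f i) (f (Suc i)))) \<and>
        (\<forall>G. dc_reduction\<^sup>*\<^sup>* (graph_rep A B) G \<and> dc_irreducible G \<longrightarrow>
           (CPC_irreducible A (TSFT A B) \<longleftrightarrow> strongly_connected (intrinsic_graph G))))
     \<and>
     (\<exists>p. decides p encode_instance
            {(A :: nat set, B :: nat block set). allowable A B}
            (\<lambda>(A, B). CPC_irreducible A (TSFT A B)))"
proof (intro conjI allI impI)
  fix A :: "'a set" and B :: "'a block set"
  assume ok: "allowable A B"
  then have "finite (verts (graph_rep A B))" by (simp add: allowable_def graph_rep_def)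
  then show "\<nexists>f. f (0 :: nat) = graph_rep A B \<and> (\<forall>i. dc_reduction (f i) (f (Suc i)))"
    by (rule no_infinite_dc_reductions)
  fix G
  assume "dc_reduction\<^sup>*\<^sup>* (graph_rep A B) G \<and> dc_irreducible G"
  then show "CPC_irreducible A (TSFT A B) \<longleftrightarrow> strongly_connected (intrinsic_graph G)"
    using CPC_irreducible_iff_attracted[OF ok] attracted_iff_strongly_connected[OF ok] by blast
qed (rule CPC_irreducible_decidable)

end
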